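(* Let $R=\bigoplus_{n\ge 0}R_n$ be a normal graded domain finitely generated over a field $k=R_0$, with canonical module $K_R$, and let $a(R)$, $b(R)$, $m(R)$ be the invariants defined in the context. Then: (1) $-a(R)+b(R)\ge 0$, and equality holds if and only if $K_R$ is a free $R$-module. If $K_R$ is not a free $R$-module, then $-a(R)+b(R)\ge m(R)$. (2) If $\mathrm{Tr}_R(K_R)=\mathfrak m_R$, then $-a(R)+b(R)=m(R)$ and $[K_R]_{-a(R)}\cdot[K_R^{-1}]_{b(R)}=R_{m(R)}$. (3) Assume that $R$ is standard graded, i.e. $R=k[R_1]$. If $-a(R)+b(R)=1$ and $[K_R]_{-a(R)}\cdot[K_R^{-1}]_{b(R)}=R_1$, then $\mathrm{Tr}_R(K_R)=\mathfrak m_R$.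
   Context: $\mathfrak m_R=\bigoplus_{n>0}R_n$. The canonical module is the graded module $K_R=[H^d_{\mathfrak m_R}(R)]^*$, $d=\dim R$, where for a graded module $M$ the graded dual $M^*$ has $[M^*]_n=\mathrm{Hom}_k(M_{-n},k)$. Let $Q(R)$ be the homogeneous total quotient ring of $R$ (localization at all nonzero homogeneous elements). Fix a graded isomorphism $K_R\otimes_R Q(R)\cong Q(R)$, through which $K_R$ is viewed as a graded fractional ideal in $Q(R)$, and put $K_R^{-1}=\bigoplus_{n\in\mathbb Z}[K_R^{-1}]_n$ with $[K_R^{-1}]_n=\{x\in Q(R)_n\mid xK_R\subset R\}$. Define $a(R)=-\min\{n\in\mathbb Z\mid [K_R]_n\ne 0\}$, $b(R)=\min\{n\in\mathbb Z\mid [K_R^{-1}]_n\neq 0\}$, $m(R)=\min\{n>0\mid R_n\ne 0\}$. The trace ideal is $\mathrm{Tr}_R(K_R)=K_R\cdot K_R^{-1}\subset R$, i.e. the ideal generated by all $f(x)$ with $f\in\mathrm{Hom}_R(K_R,R)$, $x\in K_R$. For graded pieces, $[K_R]_s\cdot[K_R^{-1}]_t\subset R_{s+t}$ denotes the $k$-span of products. *)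

theory Defs
  imports
    "HOL-Library.Extended_Nat"
    "HOL-Computational_Algebra.Computational_Algebra"
begin

section \<open>Graded rings\<close>

text \<open>The ring \<open>R\<close> is the whole type \<open>'a\<close>, its fraction field is \<open>'a fract\<close>, and a grading is the
  family \<open>G\<close> of its homogeneous components.\<close>

definition decomp :: "('i \<Rightarrow> 'b::comm_monoid_add set) \<Rightarrow> 'b \<Rightarrow> ('i \<Rightarrow> 'b) \<Rightarrow> bool" where
  "decomp M x c \<longleftrightarrow>
     finite {i. c i \<noteq> 0} \<and> (\<forall>i. c i \<in> M i) \<and> x = (\<Sum>i | c i \<noteq> 0. c i)"

definition sum_of :: "('i \<Rightarrow> 'b::comm_monoid_add set) \<Rightarrow> 'b set" where
  "sum_of M = {x. \<exists>c. decomp M x c}"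

definition graded_ring :: "(nat \<Rightarrow> 'a::comm_ring_1 set) \<Rightarrow> bool" where
  "graded_ring G \<longleftrightarrow>
     (\<forall>n. 0 \<in> G n \<and> (\<forall>x\<in>G n. \<forall>y\<in>G n. x - y \<in> G n)) \<and>
     1 \<in> G 0 \<and>
     (\<forall>m n. \<forall>x\<in>G m. \<forall>y\<in>G n. x * y \<in> G (m + n)) \<and>
     (\<forall>x. \<exists>!c. decomp G x c)"

definition subring_gen :: "'a::comm_ring_1 set \<Rightarrow> 'a set" where
  "subring_gen S = (\<lambda>A. 1 \<in> A \<and> (\<forall>x\<in>A. \<forall>y\<in>A. x - y \<in> A \<and> x * y \<in> A)) hull S"

definition integrally_closed :: "'a::idom itself \<Rightarrow> bool" where
  "integrally_closed _ \<longleftrightarrow>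
     (\<forall>q :: 'a fract. (\<exists>p :: 'a poly. lead_coeff p = 1 \<and> poly (map_poly to_fract p) q = 0)
        \<longrightarrow> q \<in> range to_fract)"

definition normal_graded_domain :: "(nat \<Rightarrow> 'a::idom set) \<Rightarrow> bool" where
  "normal_graded_domain G \<longleftrightarrow>
     graded_ring G \<and>
     (\<forall>x\<in>G 0. x \<noteq> 0 \<longrightarrow> (\<exists>y\<in>G 0. x * y = 1)) \<and>
     (\<exists>S. finite S \<and> subring_gen (G 0 \<union> S) = UNIV) \<and>
     integrally_closed TYPE('a)"

definition standard_graded :: "(nat \<Rightarrow> 'a::idom set) \<Rightarrow> bool" where
  "standard_graded G \<longleftrightarrow> subring_gen (G 0 \<union> G 1) = UNIV"

definition irrelevant_ideal :: "(nat \<Rightarrow> 'a::idom set) \<Rightarrow> 'a set" where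
  "irrelevant_ideal G = sum_of (\<lambda>n. G (Suc n))"

definition m_inv :: "(nat \<Rightarrow> 'a::idom set) \<Rightarrow> nat" where
  "m_inv G = (LEAST n. 0 < n \<and> G n \<noteq> {0})"

definition prime_ideal :: "'a::comm_ring_1 set \<Rightarrow> bool" where
  "prime_ideal P \<longleftrightarrow>
     module.subspace (*) P \<and> P \<noteq> UNIV \<and> (\<forall>x y. x * y \<in> P \<longrightarrow> x \<in> P \<or> y \<in> P)"

definition krull_dim :: "'a::comm_ring_1 itself \<Rightarrow> enat" where
  "krull_dim _ = (SUP n \<in> {n. \<exists>P :: nat \<Rightarrow> 'a set.
     (\<forall>i\<le>n. prime_ideal (P i)) \<and> (\<forall>i<n. P i \<subset> P (Suc i))}. enat n)"

section \<open>The homogeneous total quotient ring\<close>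

definition hom_units :: "(nat \<Rightarrow> 'a::idom set) \<Rightarrow> 'a set" where
  "hom_units G = (\<Union>n. G n) - {0}"

definition hQ :: "(nat \<Rightarrow> 'a::idom set) \<Rightarrow> 'a fract set" where
  "hQ G = {to_fract a / to_fract s | a s. s \<in> hom_units G}"

definition hQ_deg :: "(nat \<Rightarrow> 'a::idom set) \<Rightarrow> int \<Rightarrow> 'a fract set" where
  "hQ_deg G n = {to_fract a / to_fract s | a s i j.
     a \<in> G i \<and> s \<in> G j \<and> s \<noteq> 0 \<and> n = int i - int j}"

definition fsmult :: "'a::idom \<Rightarrow> 'a fract \<Rightarrow> 'a fract" where
  "fsmult r q = to_fract r * q"

lemma module_fsmult: "module fsmult"
  by unfold_locales (simp_all add: fsmult_def algebra_simps)

section \<open>Local cohomology\<close>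

text \<open>\<open>H\<^sup>i\<close> with support in the irrelevant ideal is the cohomology of the Cech complex on a finite
  list \<open>xs\<close> of nonzero homogeneous generators of that ideal. As \<open>R\<close> is a domain, the localization
  of \<open>R\<close> at the product of the \<open>xs ! i\<close>, \<open>i \<in> I\<close>, is a graded subring of \<open>hQ G\<close>. A cochain of
  cohomological degree \<open>i\<close> is a function on the index sets \<open>I\<close> with \<open>i\<close> elements, extended by \<open>0\<close>.
  Everything is done in one internal degree \<open>n\<close> at a time.\<close>

definition hom_generators :: "(nat \<Rightarrow> 'a::idom set) \<Rightarrow> 'a list \<Rightarrow> bool" where
  "hom_generators G xs \<longleftrightarrow>
     set xs \<subseteq> hom_units G \<and> module.span (*) (set xs) = irrelevant_ideal G"

definition loc :: "'a::idom list \<Rightarrow> nat set \<Rightarrow> 'a fract set" where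
  "loc xs I = {to_fract a / to_fract (\<Prod>i\<in>I. xs ! i) ^ e | a e. True}"

type_synonym 'a cochain = "nat set \<Rightarrow> 'a fract"

definition cech :: "(nat \<Rightarrow> 'a::idom set) \<Rightarrow> 'a list \<Rightarrow> nat \<Rightarrow> int \<Rightarrow> 'a cochain set" where
  "cech G xs i n = {c. \<forall>I.
     if I \<subseteq> {..<length xs} \<and> card I = i then c I \<in> loc xs I \<inter> hQ_deg G n else c I = 0}"

definition cech_d :: "'a::idom list \<Rightarrow> 'a cochain \<Rightarrow> 'a cochain" where
  "cech_d xs c J =
     (if J \<subseteq> {..<length xs} then \<Sum>j\<in>J. (- 1) ^ card {l\<in>J. l < j} * c (J - {j}) else 0)"

definition cocycles :: "(nat \<Rightarrow> 'a::idom set) \<Rightarrow> 'a list \<Rightarrow> nat \<Rightarrow> int \<Rightarrow> 'a cochain set" where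
  "cocycles G xs i n = {z \<in> cech G xs i n. cech_d xs z = (\<lambda>_. 0)}"

definition coboundaries :: "(nat \<Rightarrow> 'a::idom set) \<Rightarrow> 'a list \<Rightarrow> nat \<Rightarrow> int \<Rightarrow> 'a cochain set" where
  "coboundaries G xs i n =
     (case i of 0 \<Rightarrow> {\<lambda>_. 0} | Suc j \<Rightarrow> cech_d xs ` cech G xs j n)"

definition coh_class ::
    "(nat \<Rightarrow> 'a::idom set) \<Rightarrow> 'a list \<Rightarrow> nat \<Rightarrow> int \<Rightarrow> 'a cochain \<Rightarrow> 'a cochain set" where
  "coh_class G xs i n z =
     {w \<in> cocycles G xs i n. (\<lambda>I. w I - z I) \<in> coboundaries G xs i n}"

definition loc_coh ::
    "(nat \<Rightarrow> 'a::idom set) \<Rightarrow> 'a list \<Rightarrow> nat \<Rightarrow> int \<Rightarrow> 'a cochain set set" where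
  "loc_coh G xs i n = coh_class G xs i n ` cocycles G xs i n"

definition csmult :: "'a::idom \<Rightarrow> 'a cochain \<Rightarrow> 'a cochain" where
  "csmult r c = (\<lambda>I. fsmult r (c I))"

text \<open>Multiplication of a cohomology class by \<open>r\<close>, where \<open>n\<close> is the internal degree of the
  product. All members of the union are equal.\<close>

definition class_smult ::
    "(nat \<Rightarrow> 'a::idom set) \<Rightarrow> 'a list \<Rightarrow> nat \<Rightarrow> int \<Rightarrow> 'a \<Rightarrow> 'a cochain set \<Rightarrow> 'a cochain set" where
  "class_smult G xs i n r C = (\<Union>z\<in>C. coh_class G xs i n (csmult r z))"

section \<open>The canonical module\<close>

text \<open>\<open>can_mod G xs d n\<close> is the component of degree \<open>n\<close> of the graded dual of \<open>H\<^sup>d\<close>: the linear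
  maps over \<open>k = G 0\<close> from the component of degree \<open>-n\<close> of \<open>H\<^sup>d\<close> to \<open>k\<close>, extended by \<open>0\<close>.\<close>

definition can_mod ::
    "(nat \<Rightarrow> 'a::idom set) \<Rightarrow> 'a list \<Rightarrow> nat \<Rightarrow> int \<Rightarrow> ('a cochain set \<Rightarrow> 'a) set" where
  "can_mod G xs d n = {\<phi>.
     (\<forall>C. if C \<in> loc_coh G xs d (- n) then \<phi> C \<in> G 0 else \<phi> C = 0) \<and>
     (\<forall>z\<in>cocycles G xs d (- n). \<forall>w\<in>cocycles G xs d (- n).
        \<phi> (coh_class G xs d (- n) (\<lambda>I. z I + w I)) =
          \<phi> (coh_class G xs d (- n) z) + \<phi> (coh_class G xs d (- n) w)) \<and>
     (\<forall>c\<in>G 0. \<forall>z\<in>cocycles G xs d (- n).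
        \<phi> (coh_class G xs d (- n) (csmult c z)) = c * \<phi> (coh_class G xs d (- n) z))}"

text \<open>For \<open>\<phi>\<close> of degree \<open>n\<close> and \<open>r\<close> of degree \<open>j\<close>, the product \<open>r \<phi>\<close> has degree \<open>n + j\<close> and sends
  a class \<open>h\<close> of degree \<open>-(n + j)\<close> to \<open>\<phi> (r h)\<close>.\<close>

definition can_smult ::
    "(nat \<Rightarrow> 'a::idom set) \<Rightarrow> 'a list \<Rightarrow> nat \<Rightarrow> int \<Rightarrow> nat \<Rightarrow> 'a \<Rightarrow>
       ('a cochain set \<Rightarrow> 'a) \<Rightarrow> 'a cochain set \<Rightarrow> 'a" where
  "can_smult G xs d n j r \<phi> =
     (\<lambda>C. if C \<in> loc_coh G xs d (- (n + int j)) then \<phi> (class_smult G xs d (- n) r C) else 0)"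

definition deg_part :: "(nat \<Rightarrow> 'a::idom set) \<Rightarrow> 'a fract set \<Rightarrow> int \<Rightarrow> 'a fract set" where
  "deg_part G K n = K \<inter> hQ_deg G n"

definition graded_fractional_ideal :: "(nat \<Rightarrow> 'a::idom set) \<Rightarrow> 'a fract set \<Rightarrow> bool" where
  "graded_fractional_ideal G K \<longleftrightarrow>
     module.subspace fsmult K \<and> K = sum_of (deg_part G K) \<and>
     (\<exists>s\<in>hom_units G. \<forall>x\<in>K. fsmult s x \<in> range to_fract)"

text \<open>\<open>K\<close> is a graded fractional ideal that is the image of the canonical module under a graded
  isomorphism \<open>\<iota>\<close>. Tensoring with \<open>hQ G\<close> is localization at \<open>hom_units G\<close>, so the map from the
  tensor product to \<open>hQ G\<close> induced by \<open>\<iota>\<close> sends \<open>\<phi>/s\<close> to \<open>\<iota> \<phi> / s\<close>; it is injective because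
  \<open>\<iota>\<close> is, and the second condition is its surjectivity.\<close>

definition canonical_fractional_ideal ::
    "(nat \<Rightarrow> 'a::idom set) \<Rightarrow> 'a list \<Rightarrow> nat \<Rightarrow> 'a fract set \<Rightarrow> bool" where
  "canonical_fractional_ideal G xs d K \<longleftrightarrow>
     graded_fractional_ideal G K \<and>
     hQ G = {x / to_fract s | x s. x \<in> K \<and> s \<in> hom_units G} \<and>
     (\<exists>\<iota>. (\<forall>n. bij_betw (\<iota> n) (can_mod G xs d n) (deg_part G K n)) \<and>
        (\<forall>n. \<forall>\<phi>\<in>can_mod G xs d n. \<forall>\<psi>\<in>can_mod G xs d n.
           \<iota> n (\<lambda>C. \<phi> C + \<psi> C) = \<iota> n \<phi> + \<iota> n \<psi>) \<and>
        (\<forall>n j. \<forall>r\<in>G j. \<forall>\<phi>\<in>can_mod G xs d n.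
           \<iota> (n + int j) (can_smult G xs d n j r \<phi>) = fsmult r (\<iota> n \<phi>)))"

section \<open>The inverse, the trace ideal and the invariants\<close>

definition inv_part :: "(nat \<Rightarrow> 'a::idom set) \<Rightarrow> 'a fract set \<Rightarrow> int \<Rightarrow> 'a fract set" where
  "inv_part G K n = {x \<in> hQ_deg G n. \<forall>y\<in>K. x * y \<in> range to_fract}"

definition K_inv :: "(nat \<Rightarrow> 'a::idom set) \<Rightarrow> 'a fract set \<Rightarrow> 'a fract set" where
  "K_inv G K = sum_of (inv_part G K)"

text \<open>The ideal \<open>K K\<^sup>-\<^sup>1\<close> of \<open>R\<close>, as a subset of the fraction field.\<close>

definition trace_ideal :: "(nat \<Rightarrow> 'a::idom set) \<Rightarrow> 'a fract set \<Rightarrow> 'a fract set" where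
  "trace_ideal G K = module.span fsmult {x * y | x y. x \<in> K \<and> y \<in> K_inv G K}"

definition a_inv :: "(nat \<Rightarrow> 'a::idom set) \<Rightarrow> 'a fract set \<Rightarrow> int" where
  "a_inv G K = - (LEAST n. deg_part G K n \<noteq> {0})"

definition b_inv :: "(nat \<Rightarrow> 'a::idom set) \<Rightarrow> 'a fract set \<Rightarrow> int" where
  "b_inv G K = (LEAST n. inv_part G K n \<noteq> {0})"

text \<open>The linear span over \<open>k = G 0\<close> of the products of elements of \<open>A\<close> and \<open>B\<close>.\<close>

definition span_products ::
    "(nat \<Rightarrow> 'a::idom set) \<Rightarrow> 'a fract set \<Rightarrow> 'a fract set \<Rightarrow> 'a fract set" where
  "span_products G A B = {\<Sum>p\<in>F. fsmult (c p) p | F c.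
     finite F \<and> F \<subseteq> {x * y | x y. x \<in> A \<and> y \<in> B} \<and> (\<forall>p\<in>F. c p \<in> G 0)}"

definition free_module :: "'a::idom fract set \<Rightarrow> bool" where
  "free_module K \<longleftrightarrow> (\<exists>B. \<not> module.dependent fsmult B \<and> module.span fsmult B = K)"

end

theory Submission
  imports Defs
begin

text \<open>Essentially the proof uses only that \<open>K\<close> is a nonzero graded fractional ideal. Nonzero
  elements \<open>x\<close> of \<open>K\<close> and \<open>y\<close> of \<open>K\<^sup>-\<^sup>1\<close> of minimal degree have a nonzero product in \<open>R\<^sub>N\<close>,
  \<open>N = -a + b\<close>. If \<open>N = 0\<close>, this product is a unit and \<open>K = R x\<close>. Conversely, a free \<open>K\<close> is cyclic;
  its generator divides a homogeneous element, hence is homogeneous, and its inverse lies in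
  \<open>K\<^sup>-\<^sup>1\<close>, so \<open>N \<le> 0\<close>. The trace ideal lives in degrees at least \<open>N\<close>, and its part of degree \<open>N\<close> is
  the span of the products of elements of minimal degree; this gives the other two claims.\<close>

section \<open>Homogeneous components\<close>

locale graded =
  fixes G :: "nat \<Rightarrow> 'a::comm_ring_1 set"
  assumes graded_ring: "graded_ring G"
begin

lemma zero_mem: "0 \<in> G n"
  and diff_mem: "x \<in> G n \<Longrightarrow> y \<in> G n \<Longrightarrow> x - y \<in> G n"
  and one_mem: "1 \<in> G 0"
  and mult_mem: "x \<in> G m \<Longrightarrow> y \<in> G n \<Longrightarrow> x * y \<in> G (m + n)"
  and ex1_decomp: "\<exists>!c. decomp G x c"
  using graded_ring by (simp_all add: graded_ring_def)

lemma add_mem: "x \<in> G n \<Longrightarrow> y \<in> G n \<Longrightarrow> x + y \<in> G n"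
  using diff_mem[of x n "0 - y"] diff_mem[of 0 n y] zero_mem by simp

lemma sum_mem: "(\<And>i. i \<in> A \<Longrightarrow> f i \<in> G n) \<Longrightarrow> sum f A \<in> G n"
  by (induction A rule: infinite_finite_induct) (auto simp: zero_mem add_mem)

definition component :: "'a \<Rightarrow> nat \<Rightarrow> 'a" where
  "component x = (THE c. decomp G x c)"

lemma decomp_component: "decomp G x (component x)"
  using theI'[OF ex1_decomp[of x]] by (simp only: component_def)

lemma component_eqI: "decomp G x c \<Longrightarrow> component x = c"
  using ex1_decomp decomp_component by blast

lemma component_mem: "component x n \<in> G n"
  and finite_component: "finite {n. component x n \<noteq> 0}"
  and sum_component: "(\<Sum>n | component x n \<noteq> 0. component x n) = x"
  using decomp_component[of x] by (auto simp: decomp_def)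

lemma component_homogeneous: "x \<in> G n \<Longrightarrow> component x m = (if m = n then x else 0)"
proof -
  assume x: "x \<in> G n"
  have "{m. (if m = n then x else 0) \<noteq> 0} = (if x = 0 then {} else {n})" by auto
  then have "decomp G x (\<lambda>m. if m = n then x else 0)"
    using x by (auto simp: decomp_def zero_mem)
  then show ?thesis by (simp add: component_eqI)
qed

lemma component_zero: "component 0 n = 0"
  using component_homogeneous[OF zero_mem, of n n] by simp

lemma component_add: "component (x + y) n = component x n + component y n"
proof -
  \<comment> \<open>Terms can cancel in \<open>x + y\<close>, so all sums are moved to the union of
    the two supports, where the extra terms are 0.\<close>
  let ?A = "{n. component x n \<noteq> 0} \<union> {n. component y n \<noteq> 0}"
  let ?c = "\<lambda>n. component x n + component y n"
  have fin: "finite ?A" by (simp add: finite_component)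
  have sub: "{n. ?c n \<noteq> 0} \<subseteq> ?A" by auto
  have "(\<Sum>n | ?c n \<noteq> 0. ?c n) = (\<Sum>n\<in>?A. ?c n)"
    using fin sub by (intro sum.mono_neutral_left) auto
  also have "\<dots> = (\<Sum>n\<in>?A. component x n) + (\<Sum>n\<in>?A. component y n)"
    by (rule sum.distrib)
  also have "(\<Sum>n\<in>?A. component x n) = (\<Sum>n | component x n \<noteq> 0. component x n)"
    using fin by (intro sum.mono_neutral_right) auto
  also have "(\<Sum>n\<in>?A. component y n) = (\<Sum>n | component y n \<noteq> 0. component y n)"
    using fin by (intro sum.mono_neutral_right) auto
  finally have "decomp G (x + y) ?c"
    using finite_subset[OF sub fin] by (simp add: decomp_def sum_component component_mem add_mem)
  then show ?thesis by (simp add: component_eqI)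
qed

lemma component_sum: "component (sum f A) n = (\<Sum>i\<in>A. component (f i) n)"
  by (induction A rule: infinite_finite_induct) (auto simp: component_zero component_add)

text \<open>Of all products of components of \<open>x\<close> and \<open>y\<close>, only those with
  degrees \<open>i\<close> and \<open>n - i\<close> land in degree \<open>n\<close>. The form
  matches \<open>coeff_mult\<close>, on which \<open>homogeneous_factor\<close> relies.\<close>

lemma component_mult: "component (x * y) n = (\<Sum>i\<le>n. component x i * component y (n - i))"
proof -
  let ?A = "{i. component x i \<noteq> 0}" and ?B = "{j. component y j \<noteq> 0}"
  have "x * y = (\<Sum>i\<in>?A. component x i) * (\<Sum>j\<in>?B. component y j)"
    by (simp only: sum_component)
  also have "\<dots> = (\<Sum>i\<in>?A. \<Sum>j\<in>?B. component x i * component y j)"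
    by (simp add: sum_product)
  finally have "component (x * y) n =
      (\<Sum>i\<in>?A. \<Sum>j\<in>?B. component (component x i * component y j) n)"
    by (simp add: component_sum)
  also have "\<dots> = (\<Sum>i\<in>?A. \<Sum>j\<in>?B. if n = i + j then component x i * component y j else 0)"
    by (intro sum.cong refl component_homogeneous mult_mem component_mem)
  also have "\<dots> = (\<Sum>i\<in>?A. if i \<le> n then component x i * component y (n - i) else 0)"
  proof (intro sum.cong refl)
    fix i
    \<comment> \<open>The guard \<open>i \<le> n\<close> is kept because \<open>n - i\<close>
      truncates to 0 for larger \<open>i\<close>, where no \<open>j\<close> contributes.\<close>
    have "(\<Sum>j\<in>?B. if n = i + j then component x i * component y j else 0) =
        (\<Sum>j\<in>?B. if j = n - i then if i \<le> n then component x i * component y j else 0 else 0)"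
      by (intro sum.cong) auto
    also have "\<dots> = (if i \<le> n then component x i * component y (n - i) else 0)"
      by (auto simp: sum.delta[OF finite_component])
    finally show "(\<Sum>j\<in>?B. if n = i + j then component x i * component y j else 0) =
        (if i \<le> n then component x i * component y (n - i) else 0)" .
  qed
  also have "\<dots> = (\<Sum>i\<in>?A \<inter> {..n}. component x i * component y (n - i))"
    by (auto simp: sum.inter_restrict[OF finite_component] intro!: sum.cong)
  also have "\<dots> = (\<Sum>i\<le>n. component x i * component y (n - i))"
    by (intro sum.mono_neutral_left) auto
  finally show ?thesis .
qed

lemma component_mult_homogeneous:
  assumes "s \<in> G j"
  shows "component (s * x) (j + n) = s * component x n"
proof -
  have "component (s * x) (j + n) = (\<Sum>i\<le>j + n. if i = j then s * component x n else 0)"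
    unfolding component_mult by (intro sum.cong) (auto simp: component_homogeneous[OF assms])
  then show ?thesis by (simp add: sum.delta)
qed

lemma homogeneous_iff: "x \<in> G n \<longleftrightarrow> (\<forall>m. m \<noteq> n \<longrightarrow> component x m = 0)"
proof
  assume "\<forall>m. m \<noteq> n \<longrightarrow> component x m = 0"
  then have "{m. component x m \<noteq> 0} \<subseteq> {n}" by auto
  then have "(\<Sum>m | component x m \<noteq> 0. component x m) \<in> G n"
    by (intro sum_mem) (auto simp: component_mem)
  then show "x \<in> G n" by (simp add: sum_component)
qed (simp add: component_homogeneous)

end

interpretation fsm: module fsmult
  by (rule module_fsmult)

text \<open>A factor of a homogeneous element is homogeneous because \<open>x \<mapsto> \<Sum>n. x\<^sub>n t\<^sup>n\<close> is an injective ring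
  homomorphism from \<open>R\<close> to \<open>R[t]\<close> under which homogeneous elements become monomials.\<close>

lemma monom_if_order_eq_degree:
  fixes p :: "'a::idom poly"
  assumes "p \<noteq> 0" "order 0 p = degree p"
  obtains c where "p = monom c (degree p)"
proof -
  \<comment> \<open>The order at 0 is the lowest exponent. When it equals the degree, the cofactor
    of this monomial is a constant.\<close>
  have "monom 1 (degree p) dvd p"
    using order_1[of 0 p] assms by (simp add: monom_altdef)
  then obtain q where q: "p = monom 1 (degree p) * q" by (elim dvdE)
  with assms have "q \<noteq> 0" by auto
  then have "degree p = degree p + degree q"
    by (subst (1) q) (simp add: degree_mult_eq degree_monom_eq)
  then obtain c where "q = [:c:]" by (metis add_cancel_right_right degree_eq_zeroE)
  with q that[of c] show ?thesis by (simp add: monom_altdef)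
qed

locale graded_domain = graded G for G :: "nat \<Rightarrow> 'a::idom set"
begin

lemma homogeneous_factor:
  assumes "p * q \<in> G n" "p * q \<noteq> 0"
  shows "\<exists>m. p \<in> G m"
proof -
  define h where "h = (\<lambda>x. Abs_poly (component x))"
  have coeff_h: "coeff (h x) = component x" for x
    using finite_component[of x] by (simp add: h_def Abs_poly_inverse eventually_cofinite)
  have h0: "h x = 0 \<longleftrightarrow> x = 0" for x
  proof
    assume "h x = 0"
    then have "component x m = 0" for m by (metis coeff_0 coeff_h)
    then show "x = 0" using sum_component[of x] by simp
  qed (simp add: poly_eq_iff coeff_h component_zero)
  have "h (p * q) = monom (p * q) n"
    by (rule poly_eqI) (simp add: coeff_h component_homogeneous[OF assms(1)])
  moreover have "h (p * q) = h p * h q"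
    by (rule poly_eqI) (simp add: coeff_h component_mult coeff_mult)
  ultimately have pq: "h p * h q = monom (p * q) n" by simp
  have nz: "h p \<noteq> 0" "h q \<noteq> 0" using assms(2) by (auto simp: h0)
  \<comment> \<open>Highest and lowest exponents are both additive over a domain, and both add up to
    \<open>n\<close>. As the lowest never exceeds the highest, the two agree in each factor.\<close>
  have "degree (h p) + degree (h q) = n"
    using pq assms(2) nz by (metis degree_monom_eq degree_mult_eq)
  moreover have "order 0 (h p) + order 0 (h q) = n"
    using pq assms(2) nz by (metis mult_eq_0_iff order_0_monom order_mult)
  ultimately have "order 0 (h p) = degree (h p)"
    using order_degree[OF nz(1), of 0] order_degree[OF nz(2), of 0] by linarith
  then obtain c where c: "h p = monom c (degree (h p))"
    using monom_if_order_eq_degree nz(1) by blast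
  have "component p m = 0" if "m \<noteq> degree (h p)" for m
    using that by (metis c coeff_h coeff_monom)
  then show ?thesis using homogeneous_iff by blast
qed

text \<open>The family \<open>\<lambda>n. G (Suc n)\<close> omits only degree 0, so a decomposition
  along it is one along \<open>G\<close> without a term in degree 0, reindexed by
  \<open>Suc\<close>.\<close>

lemma mem_irrelevant_ideal_iff: "x \<in> irrelevant_ideal G \<longleftrightarrow> component x 0 = 0"
proof
  assume "x \<in> irrelevant_ideal G"
  then obtain c where c: "decomp (\<lambda>n. G (Suc n)) x c"
    by (auto simp: irrelevant_ideal_def sum_of_def)
  then have "component x 0 = (\<Sum>i | c i \<noteq> 0. component (c i) 0)"
    by (simp add: decomp_def component_sum)
  also have "\<dots> = 0"
    using c component_homogeneous[of "c _" "Suc _" 0] by (intro sum.neutral) (auto simp: decomp_def)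
  finally show "component x 0 = 0" .
next
  assume 0: "component x 0 = 0"
  let ?c = "\<lambda>n. component x (Suc n)"
  have eq: "{n. component x n \<noteq> 0} = Suc ` {n. ?c n \<noteq> 0}"
  proof (intro set_eqI iffI)
    fix n assume "n \<in> {n. component x n \<noteq> 0}"
    with 0 show "n \<in> Suc ` {n. ?c n \<noteq> 0}" by (cases n) auto
  qed auto
  have "finite {n. ?c n \<noteq> 0}"
    using finite_component[of x] by (simp add: eq finite_image_iff)
  moreover have "(\<Sum>n | component x n \<noteq> 0. component x n) = (\<Sum>n | ?c n \<noteq> 0. ?c n)"
    unfolding eq by (simp add: sum.reindex)
  ultimately have "decomp (\<lambda>n. G (Suc n)) x ?c"
    by (simp add: decomp_def component_mem sum_component)
  then show "x \<in> irrelevant_ideal G"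
    by (auto simp: irrelevant_ideal_def sum_of_def)
qed

section \<open>Degrees in the total quotient ring\<close>

lemma hQ_degI: "a \<in> G i \<Longrightarrow> s \<in> G j \<Longrightarrow> s \<noteq> 0 \<Longrightarrow> to_fract a / to_fract s \<in> hQ_deg G (int i - int j)"
  by (auto simp: hQ_deg_def)

lemma to_fract_mem_hQ_deg: "a \<in> G i \<Longrightarrow> to_fract a \<in> hQ_deg G (int i)"
  using hQ_degI[of a i 1 0] one_mem by simp

lemma mult_mem_hQ_deg:
  assumes "x \<in> hQ_deg G m" "y \<in> hQ_deg G n"
  shows "x * y \<in> hQ_deg G (m + n)"
proof -
  obtain a s i j where x: "x = to_fract a / to_fract s" "a \<in> G i" "s \<in> G j" "s \<noteq> 0"
      "m = int i - int j"
    using assms(1) by (auto simp: hQ_deg_def)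
  obtain b t k l where y: "y = to_fract b / to_fract t" "b \<in> G k" "t \<in> G l" "t \<noteq> 0"
      "n = int k - int l"
    using assms(2) by (auto simp: hQ_deg_def)
  have "x * y = to_fract (a * b) / to_fract (s * t)" using x y by simp
  moreover have "m + n = int (i + k) - int (j + l)" using x(5) y(5) by simp
  moreover have "to_fract (a * b) / to_fract (s * t) \<in> hQ_deg G (int (i + k) - int (j + l))"
    using x y by (intro hQ_degI mult_mem) auto
  ultimately show ?thesis by simp
qed

lemma inverse_mem_hQ_deg:
  assumes "x \<in> hQ_deg G n" "x \<noteq> 0"
  shows "inverse x \<in> hQ_deg G (- n)"
proof -
  obtain a s i j where "x = to_fract a / to_fract s" "a \<in> G i" "s \<in> G j" "s \<noteq> 0"
      "n = int i - int j"
    using assms(1) by (auto simp: hQ_deg_def)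
  then show ?thesis using assms(2) hQ_degI[of s j a i] by simp
qed

text \<open>A fraction of degree \<open>n\<close> supplies a nonzero denominator of a suitable
  degree, over which 0 can be the numerator. Without such a denominator the set is empty.\<close>

lemma zero_mem_hQ_deg: "hQ_deg G n \<noteq> {} \<Longrightarrow> 0 \<in> hQ_deg G n"
  using zero_mem by (fastforce simp: hQ_deg_def)

text \<open>Clearing the denominator gives \<open>s * p = a\<close>. In degree \<open>j + m\<close>
  this reads \<open>s * component p m\<close>, which vanishes unless \<open>j + m = i\<close>; in a
  domain \<open>p\<close> then has no component outside degree \<open>n = i - j\<close>.\<close>

lemma to_fract_in_hQ_deg:
  assumes "to_fract p \<in> hQ_deg G n" "p \<noteq> 0"
  shows "0 \<le> n" "p \<in> G (nat n)"
proof -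
  obtain a s i j where a: "to_fract p = to_fract a / to_fract s" "a \<in> G i" "s \<in> G j" "s \<noteq> 0"
      "n = int i - int j"
    using assms(1) by (auto simp: hQ_deg_def)
  then have "to_fract (s * p) = to_fract a" by (simp add: field_simps)
  then have sp: "s * p = a" by (simp only: to_fract_eq_iff)
  have comp: "component p m = 0" if "int m \<noteq> n" for m
    using component_mult_homogeneous[OF a(3), of p m] component_homogeneous[OF a(2), of "j + m"]
      a that by (auto simp: sp)
  show n: "0 \<le> n"
  proof (rule ccontr)
    assume "\<not> 0 \<le> n"
    then have "component p m = 0" for m by (intro comp) auto
    then show False using sum_component[of p] assms(2) by simp
  qed
  show "p \<in> G (nat n)"
    unfolding homogeneous_iff using comp n by auto
qed

section \<open>Linear spans of products over \<open>G 0\<close>\<close>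

lemma span_products_base:
  "x \<in> A \<Longrightarrow> y \<in> B \<Longrightarrow> x * y \<in> span_products G A B"
  unfolding span_products_def
  by (rule CollectI, rule exI[of _ "{x * y}"], rule exI[of _ "\<lambda>_. 1"])
    (auto simp: one_mem fsmult_def)

lemma span_products_add:
  assumes "u \<in> span_products G A B" "v \<in> span_products G A B"
  shows "u + v \<in> span_products G A B"
proof -
  let ?P = "{x * y | x y. x \<in> A \<and> y \<in> B}"
  obtain F c where F: "u = (\<Sum>p\<in>F. fsmult (c p) p)" "finite F" "F \<subseteq> ?P" "\<And>p. p \<in> F \<Longrightarrow> c p \<in> G 0"
    using assms(1) by (auto simp: span_products_def)
  obtain E e where E: "v = (\<Sum>p\<in>E. fsmult (e p) p)" "finite E" "E \<subseteq> ?P" "\<And>p. p \<in> E \<Longrightarrow> e p \<in> G 0"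
    using assms(2) by (auto simp: span_products_def)
  \<comment> \<open>A span element carries one coefficient per product, so coefficients are added
    where \<open>F\<close> and \<open>E\<close> overlap and count as 0 outside their own
    set.\<close>
  let ?g = "\<lambda>p. (if p \<in> F then c p else 0) + (if p \<in> E then e p else 0)"
  have "(\<Sum>p\<in>F \<union> E. fsmult (?g p) p) =
      (\<Sum>p\<in>F \<union> E. fsmult (if p \<in> F then c p else 0) p) +
      (\<Sum>p\<in>F \<union> E. fsmult (if p \<in> E then e p else 0) p)"
    by (simp add: fsm.scale_left_distrib sum.distrib)
  also have "(\<Sum>p\<in>F \<union> E. fsmult (if p \<in> F then c p else 0) p) = u"
    unfolding F(1) using F(2) E(2) by (intro sum.mono_neutral_cong_right) auto
  also have "(\<Sum>p\<in>F \<union> E. fsmult (if p \<in> E then e p else 0) p) = v"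
    unfolding E(1) using F(2) E(2) by (intro sum.mono_neutral_cong_right) auto
  finally have "u + v = (\<Sum>p\<in>F \<union> E. fsmult (?g p) p)" by simp
  moreover have "?g p \<in> G 0" for p using F(4) E(4) by (simp add: zero_mem add_mem)
  moreover have "finite (F \<union> E)" "F \<union> E \<subseteq> ?P" using F E by auto
  ultimately show ?thesis
    unfolding span_products_def by (intro CollectI exI[of _ "F \<union> E"] exI[of _ ?g]) auto
qed

lemma span_products_scale:
  assumes "r \<in> G 0" "u \<in> span_products G A B"
  shows "to_fract r * u \<in> span_products G A B"
proof -
  let ?P = "{x * y | x y. x \<in> A \<and> y \<in> B}"
  obtain F c where F: "u = (\<Sum>p\<in>F. fsmult (c p) p)" "finite F" "F \<subseteq> ?P" "\<And>p. p \<in> F \<Longrightarrow> c p \<in> G 0"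
    using assms(2) by (auto simp: span_products_def)
  have "to_fract r * u = (\<Sum>p\<in>F. fsmult (r * c p) p)"
    unfolding F(1) sum_distrib_left by (simp add: fsmult_def mult.assoc)
  moreover have "\<And>p. p \<in> F \<Longrightarrow> r * c p \<in> G 0"
    using F(4) assms(1) mult_mem[of r 0 _ 0] by simp
  ultimately show ?thesis
    unfolding span_products_def using F
    by (intro CollectI exI[of _ F] exI[of _ "\<lambda>p. r * c p"]) auto
qed

lemma span_products_zero: "0 \<in> span_products G A B"
  unfolding span_products_def by (rule CollectI, rule exI[of _ "{}"]) auto

end

section \<open>Fractional ideals\<close>

text \<open>As \<open>int\<close> is not well-ordered, \<open>LEAST\<close> is meaningful only below
  a bound \<open>l\<close>; subtracting \<open>l\<close> moves the minimum to
  \<open>nat\<close>.\<close>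

lemma int_Least:
  fixes P :: "int \<Rightarrow> bool"
  assumes "P k" "\<And>n. P n \<Longrightarrow> l \<le> n"
  shows "P (LEAST n. P n)" "P n \<Longrightarrow> (LEAST n. P n) \<le> n"
proof -
  obtain m where m: "P m" "\<And>n. P n \<Longrightarrow> nat (m - l) \<le> nat (n - l)"
    using ex_has_least_nat[of P k "\<lambda>n. nat (n - l)"] assms(1) by blast
  then have "m \<le> n" if "P n" for n
    using assms(2)[OF that] assms(2)[OF m(1)] m(2)[OF that] by linarith
  with m(1) show "P (LEAST n. P n)" "P n \<Longrightarrow> (LEAST n. P n) \<le> n"
    by (metis Least_equality)+
qed

text \<open>If \<open>R = k\<close>, then \<open>hQ_deg G n\<close> is empty for \<open>n < 0\<close>, so that \<open>deg_part G K n \<noteq> {0}\<close> has no least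
  solution; the assumption \<open>hQ_deg_nonempty\<close> excludes this. It holds for a canonical ideal, because
  \<open>can_mod G xs d n\<close> contains \<open>0\<close> and is in bijection with \<open>deg_part G K n\<close>.\<close>

locale graded_fractional = graded_domain G for G :: "nat \<Rightarrow> 'a::idom set" +
  fixes K :: "'a fract set"
  assumes ideal: "graded_fractional_ideal G K"
    and nonzero: "\<exists>x\<in>K. x \<noteq> 0"
    and hQ_deg_nonempty: "hQ_deg G n \<noteq> {}"
    and unit: "c \<in> G 0 \<Longrightarrow> c \<noteq> 0 \<Longrightarrow> \<exists>c'\<in>G 0. c * c' = 1"
begin

lemma subspace: "fsm.subspace K"
  and denominator: "\<exists>s\<in>hom_units G. \<forall>x\<in>K. fsmult s x \<in> range to_fract"
  using ideal unfolding graded_fractional_ideal_def by blast+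

lemma decomp_ex: "x \<in> K \<Longrightarrow> \<exists>c. decomp (deg_part G K) x c"
  using ideal unfolding graded_fractional_ideal_def sum_of_def by blast

lemma obtain_denominator:
  obtains s j where "s \<in> G j" "s \<noteq> 0" "\<And>x. x \<in> K \<Longrightarrow> to_fract s * x \<in> range to_fract"
  using denominator by (auto simp: hom_units_def fsmult_def)

text \<open>The empty set differs from \<open>{0}\<close> too; this case is excluded because 0 lies
  in every degree part.\<close>

lemma deg_part_ne_iff: "deg_part G K n \<noteq> {0} \<longleftrightarrow> (\<exists>x\<in>deg_part G K n. x \<noteq> 0)"
proof -
  have "0 \<in> deg_part G K n"
    using fsm.subspace_0[OF subspace] zero_mem_hQ_deg[OF hQ_deg_nonempty] by (simp add: deg_part_def)
  then show ?thesis by auto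
qed

lemma inv_part_ne_iff: "inv_part G K n \<noteq> {0} \<longleftrightarrow> (\<exists>x\<in>inv_part G K n. x \<noteq> 0)"
proof -
  have "(0::'a fract) \<in> range to_fract" by (metis rangeI to_fract_0)
  then have "0 \<in> inv_part G K n"
    using zero_mem_hQ_deg[OF hQ_deg_nonempty] by (simp add: inv_part_def)
  then show ?thesis by auto
qed

lemma prod_mem:
  assumes "x \<in> deg_part G K m" "y \<in> inv_part G K n" "x * y \<noteq> 0"
  obtains p where "x * y = to_fract p" "0 \<le> m + n" "p \<in> G (nat (m + n))" "p \<noteq> 0"
proof -
  have "y * x \<in> range to_fract" and deg: "x * y \<in> hQ_deg G (m + n)"
    using assms mult_mem_hQ_deg by (auto simp: deg_part_def inv_part_def)
  then obtain p where p: "x * y = to_fract p" by (auto simp: mult.commute)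
  with assms(3) have "p \<noteq> 0" by auto
  with p deg to_fract_in_hQ_deg[of p "m + n"] that show ?thesis by auto
qed

section \<open>Lowest degrees of \<open>K\<close> and of its inverse\<close>

lemma deg_part_nonzero_ex: "\<exists>n. deg_part G K n \<noteq> {0}"
proof -
  obtain x where x: "x \<in> K" "x \<noteq> 0" using nonzero by blast
  then obtain c where "decomp (deg_part G K) x c" using decomp_ex by blast
  then have c: "x = (\<Sum>i | c i \<noteq> 0. c i)" "\<And>i. c i \<in> deg_part G K i" by (auto simp: decomp_def)
  have "\<exists>i. c i \<noteq> 0"
  proof (rule ccontr)
    assume "\<not> (\<exists>i. c i \<noteq> 0)"
    with c(1) x(2) show False by simp
  qed
  with c(2) show ?thesis by (auto simp: deg_part_ne_iff)
qed

text \<open>The common denominator of \<open>K\<close> is itself a nonzero homogeneous element of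
  the inverse.\<close>

lemma inv_part_nonzero_ex: "\<exists>n. inv_part G K n \<noteq> {0}"
proof -
  obtain s j where s: "s \<in> G j" "s \<noteq> 0" "\<And>x. x \<in> K \<Longrightarrow> to_fract s * x \<in> range to_fract"
    using obtain_denominator by blast
  then have "to_fract s \<in> inv_part G K (int j)" by (simp add: inv_part_def to_fract_mem_hQ_deg)
  with s(2) show ?thesis unfolding inv_part_ne_iff by (metis to_fract_eq_0_iff)
qed

text \<open>A product of nonzero elements is a nonzero element of \<open>R\<close>, which has no
  negative degrees. Any one degree occurring in \<open>K\<close> thus bounds those of the inverse
  from below, and conversely, so that both minima exist.\<close>

lemma deg_sum_nonneg:
  assumes "deg_part G K m \<noteq> {0}" "inv_part G K n \<noteq> {0}"
  shows "0 \<le> m + n"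
proof -
  obtain x y where "x \<in> deg_part G K m" "x \<noteq> 0" "y \<in> inv_part G K n" "y \<noteq> 0"
    using assms by (auto simp: deg_part_ne_iff inv_part_ne_iff)
  then show ?thesis by (metis mult_eq_0_iff prod_mem)
qed

lemma deg_part_a_inv: "deg_part G K (- a_inv G K) \<noteq> {0}"
  and a_inv_le: "deg_part G K n \<noteq> {0} \<Longrightarrow> - a_inv G K \<le> n"
proof -
  obtain k l where k: "deg_part G K k \<noteq> {0}" and l: "inv_part G K l \<noteq> {0}"
    using deg_part_nonzero_ex inv_part_nonzero_ex by blast
  have "- l \<le> n" if "deg_part G K n \<noteq> {0}" for n using deg_sum_nonneg[OF that l] by simp
  from int_Least[of "\<lambda>n. deg_part G K n \<noteq> {0}", OF k this]
  show "deg_part G K (- a_inv G K) \<noteq> {0}" "deg_part G K n \<noteq> {0} \<Longrightarrow> - a_inv G K \<le> n"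
    by (simp_all add: a_inv_def)
qed

lemma inv_part_b_inv: "inv_part G K (b_inv G K) \<noteq> {0}"
  and b_inv_le: "inv_part G K n \<noteq> {0} \<Longrightarrow> b_inv G K \<le> n"
proof -
  obtain k l where k: "deg_part G K k \<noteq> {0}" and l: "inv_part G K l \<noteq> {0}"
    using deg_part_nonzero_ex inv_part_nonzero_ex by blast
  have "- k \<le> n" if "inv_part G K n \<noteq> {0}" for n using deg_sum_nonneg[OF k that] by simp
  from int_Least[of "\<lambda>n. inv_part G K n \<noteq> {0}", OF l this]
  show "inv_part G K (b_inv G K) \<noteq> {0}" "inv_part G K n \<noteq> {0} \<Longrightarrow> b_inv G K \<le> n"
    by (simp_all add: b_inv_def)
qed

text \<open>Taken in \<open>nat\<close> to serve as an index of \<open>G\<close>; by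
  \<open>int_N\<close> nothing is truncated.\<close>

definition N :: nat where "N = nat (- a_inv G K + b_inv G K)"

lemma int_N: "int N = - a_inv G K + b_inv G K"
  using deg_sum_nonneg[OF deg_part_a_inv inv_part_b_inv] by (simp add: N_def)

lemma obtain_lowest:
  obtains x y p where "x \<in> deg_part G K (- a_inv G K)" "y \<in> inv_part G K (b_inv G K)"
    "x * y = to_fract p" "p \<in> G N" "p \<noteq> 0"
proof -
  obtain x y where xy: "x \<in> deg_part G K (- a_inv G K)" "x \<noteq> 0"
      "y \<in> inv_part G K (b_inv G K)" "y \<noteq> 0"
    using deg_part_a_inv inv_part_b_inv by (auto simp: deg_part_ne_iff inv_part_ne_iff)
  then obtain p where "x * y = to_fract p" "p \<in> G (nat (- a_inv G K + b_inv G K))" "p \<noteq> 0"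
    using prod_mem by (metis mult_eq_0_iff)
  with xy that show ?thesis by (simp add: N_def)
qed

text \<open>The product from \<open>obtain_lowest\<close> makes \<open>N\<close> a competitor in the
  minimum that defines \<open>m_inv\<close>.\<close>

lemma m_inv_le: "N \<noteq> 0 \<Longrightarrow> m_inv G \<le> N"
  unfolding m_inv_def using obtain_lowest by (intro Least_le) (metis empty_iff gr0I insert_iff)

section \<open>Freeness\<close>

lemma free_if_N_eq_0:
  assumes "N = 0"
  shows "free_module K"
proof -
  obtain x y p where xy: "x \<in> deg_part G K (- a_inv G K)" "y \<in> inv_part G K (b_inv G K)"
      "x * y = to_fract p" "p \<in> G 0" "p \<noteq> 0"
    using obtain_lowest assms by metis
  obtain p' where p': "p * p' = 1" using unit xy by blast
  have x: "x \<in> K" "x \<noteq> 0" using xy by (auto simp: deg_part_def)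
  have "z \<in> fsm.span {x}" if "z \<in> K" for z
  proof -
    \<comment> \<open>With \<open>p'\<close> the inverse of \<open>x * y\<close>, one has
      \<open>z = p' * (x * y) * z = p' * (y * z) * x\<close>, and \<open>y * z\<close> lies in
      \<open>R\<close>.\<close>
    have "y * z \<in> range to_fract" using xy that by (simp add: inv_part_def)
    then obtain r where "y * z = to_fract r" by blast
    moreover have "to_fract p' * (x * y) = 1"
      using p' xy(3) by (metis mult.commute to_fract_1 to_fract_mult)
    ultimately have "z = fsmult (p' * r) x"
      by (simp add: fsmult_def) (metis mult.assoc mult.commute mult.right_neutral)
    then show ?thesis by (simp add: fsm.span_base fsm.span_scale)
  qed
  moreover have "fsm.span {x} \<subseteq> K" using x subspace by (intro fsm.span_minimal) auto
  ultimately have "fsm.span {x} = K" by blast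
  moreover have "fsm.independent {x}"
    using x by (auto simp: fsm.dependent_finite fsmult_def)
  ultimately show ?thesis by (auto simp: free_module_def)
qed

text \<open>Two elements of a fraction field are always dependent: if \<open>s * x = p\<close> and
  \<open>s * y = q\<close>, then \<open>q * x - p * y = 0\<close>. A basis of the nonzero module
  \<open>K\<close> therefore has exactly one element.\<close>

lemma free_imp_cyclic:
  assumes "free_module K"
  obtains x where "x \<in> K" "x \<noteq> 0" "\<And>z. z \<in> K \<Longrightarrow> \<exists>r. z = fsmult r x"
proof -
  obtain B where B: "fsm.independent B" "fsm.span B = K"
    using assms by (auto simp: free_module_def)
  have BK: "B \<subseteq> K" using B(2) fsm.span_superset by blast
  have "B \<noteq> {}" using nonzero B(2) by auto
  then obtain x where x: "x \<in> B" by blast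
  have x0: "x \<noteq> 0" using x B(1) fsm.dependent_zero by blast
  have "y = x" if y: "y \<in> B" for y
  proof (rule ccontr)
    assume "y \<noteq> x"
    obtain s j where s: "s \<noteq> 0" "\<And>x. x \<in> K \<Longrightarrow> to_fract s * x \<in> range to_fract"
      using obtain_denominator by metis
    obtain p q where p: "to_fract s * x = to_fract p" and q: "to_fract s * y = to_fract q"
      using s(2) x y BK by (metis rangeE subsetD)
    define u where "u = (\<lambda>v. if v = x then q else - p)"
    have "(\<Sum>v\<in>{x, y}. fsmult (u v) v) = to_fract q * x - to_fract p * y"
      using \<open>y \<noteq> x\<close> by (simp add: u_def fsmult_def)
    also have "\<dots> = 0" by (simp flip: p q)
    finally have "(\<Sum>v\<in>{x, y}. fsmult (u v) v) = 0" .
    moreover have "u y \<noteq> 0"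
    proof -
      have "to_fract p \<noteq> 0" unfolding p[symmetric] using s(1) x0 by simp
      then show ?thesis using \<open>y \<noteq> x\<close> by (simp add: u_def)
    qed
    ultimately have "fsm.dependent B"
      unfolding fsm.dependent_explicit using x y by (intro exI[of _ "{x, y}"] exI[of _ u]) auto
    with B(1) show False by blast
  qed
  with x have "B = {x}" by blast
  then have "\<exists>r. z = fsmult r x" if "z \<in> K" for z
    using that B(2) by (auto simp: fsm.span_singleton)
  with x BK x0 that show ?thesis by blast
qed

lemma N_eq_0_if_free:
  assumes "free_module K"
  shows "N = 0"
proof -
  obtain x where x: "x \<in> K" "x \<noteq> 0" and gen: "\<And>z. z \<in> K \<Longrightarrow> \<exists>r. z = fsmult r x"
    using free_imp_cyclic[OF assms] by blast
  obtain s j where s: "s \<in> G j" "s \<noteq> 0" "\<And>x. x \<in> K \<Longrightarrow> to_fract s * x \<in> range to_fract"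
    using obtain_denominator by blast
  obtain z where z: "z \<in> K" "z \<in> hQ_deg G (- a_inv G K)" "z \<noteq> 0"
    using deg_part_a_inv unfolding deg_part_ne_iff by (auto simp: deg_part_def)
  obtain r where r: "z = to_fract r * x" using gen[OF z(1)] by (auto simp: fsmult_def)
  obtain p where p: "to_fract s * x = to_fract p" using s(3)[OF x(1)] by blast
  \<comment> \<open>Multiplying by \<open>s\<close> turns \<open>z = r * x\<close> into a
    factorization inside \<open>R\<close> of a nonzero homogeneous element, as
    \<open>homogeneous_factor\<close> requires.\<close>
  have "to_fract s * z = to_fract (p * r)" by (simp add: r flip: p)
  moreover have "to_fract s * z \<in> hQ_deg G (int j - a_inv G K)"
    using mult_mem_hQ_deg[OF to_fract_mem_hQ_deg[OF s(1)] z(2)] by simp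
  moreover have nz: "p * r \<noteq> 0"
    using z(3) s(2) r p by auto
  ultimately have "p * r \<in> G (nat (int j - a_inv G K))"
    using to_fract_in_hQ_deg by metis
  then obtain i where i: "p \<in> G i" using homogeneous_factor nz by blast
  have x_eq: "x = to_fract p / to_fract s" using p s(2) by (simp add: field_simps)
  define n where "n = int i - int j"
  have xn: "x \<in> hQ_deg G n" unfolding x_eq n_def using i s by (intro hQ_degI)
  have "inverse x * w \<in> range to_fract" if "w \<in> K" for w
  proof -
    from gen[OF that] obtain q where "w = to_fract q * x" by (auto simp: fsmult_def)
    then have "inverse x * w = to_fract q" using x(2) by simp
    then show ?thesis by simp
  qed
  then have "inverse x \<in> inv_part G K (- n)"
    using inverse_mem_hQ_deg[OF xn x(2)] by (simp add: inv_part_def)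
  \<comment> \<open>The generator has degree \<open>n\<close> and its inverse degree
    \<open>- n\<close>, so the two minimal degrees add up to at most 0.\<close>
  then have "b_inv G K \<le> - n"
    using x(2) b_inv_le[of "- n"] inv_part_ne_iff[of "- n"] by (metis inverse_nonzero_iff_nonzero)
  moreover have "- a_inv G K \<le> n"
    using x xn a_inv_le[of n] deg_part_ne_iff[of n] by (auto simp: deg_part_def)
  ultimately show ?thesis using int_N by linarith
qed

section \<open>The trace ideal\<close>

abbreviation L :: "'a fract set" where
  "L \<equiv> span_products G (deg_part G K (- a_inv G K)) (inv_part G K (b_inv G K))"

lemma L_subset: "L \<subseteq> to_fract ` G N"
proof
  fix u assume "u \<in> L"
  then obtain F c where F: "u = (\<Sum>p\<in>F. fsmult (c p) p)" "\<And>p. p \<in> F \<Longrightarrow> c p \<in> G 0"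
      "F \<subseteq> {x * y | x y. x \<in> deg_part G K (- a_inv G K) \<and> y \<in> inv_part G K (b_inv G K)}"
    by (auto simp: span_products_def)
  have "\<exists>q\<in>G N. p = to_fract q" if p: "p \<in> F" for p
  \<comment> \<open>\<open>prod_mem\<close> covers nonzero products only.\<close>
  proof (cases "p = 0")
    case True
    then show ?thesis by (intro bexI[of _ 0]) (auto simp: zero_mem)
  next
    case False
    obtain x y where "p = x * y" "x \<in> deg_part G K (- a_inv G K)" "y \<in> inv_part G K (b_inv G K)"
      using F(3) p by blast
    with False show ?thesis unfolding N_def by (metis prod_mem)
  qed
  then obtain q where q: "\<And>p. p \<in> F \<Longrightarrow> q p \<in> G N \<and> p = to_fract (q p)" by metis
  have "u = (\<Sum>p\<in>F. to_fract (c p * q p))"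
    unfolding F(1) by (intro sum.cong refl) (use q in \<open>simp add: fsmult_def\<close>)
  then have "u = to_fract (\<Sum>p\<in>F. c p * q p)" by simp
  moreover have "(\<Sum>p\<in>F. c p * q p) \<in> G N"
    using F(2) q by (intro sum_mem) (metis add_0 mult_mem)
  ultimately show "u \<in> to_fract ` G N" by blast
qed

lemma inv_part_subset_K_inv: "inv_part G K n \<subseteq> K_inv G K"
proof
  fix y assume y: "y \<in> inv_part G K n"
  \<comment> \<open>\<open>decomp\<close> asks for a member of the family at every index, also where
    the coefficient is 0.\<close>
  have zero: "0 \<in> inv_part G K i" for i
    using zero_mem_hQ_deg[OF hQ_deg_nonempty] by (auto simp: inv_part_def intro: image_eqI[of _ _ 0])
  have "{i. (if i = n then y else 0) \<noteq> 0} = (if y = 0 then {} else {n})" by auto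
  then have "decomp (inv_part G K) y (\<lambda>i. if i = n then y else 0)"
    using y zero by (auto simp: decomp_def)
  then show "y \<in> K_inv G K" by (auto simp: K_inv_def sum_of_def)
qed

lemma L_subset_trace_ideal: "L \<subseteq> trace_ideal G K"
proof
  fix u assume "u \<in> L"
  then obtain F c where F: "u = (\<Sum>p\<in>F. fsmult (c p) p)" "finite F"
      "F \<subseteq> {x * y | x y. x \<in> deg_part G K (- a_inv G K) \<and> y \<in> inv_part G K (b_inv G K)}"
    by (auto simp: span_products_def)
  have "F \<subseteq> {x * y | x y. x \<in> K \<and> y \<in> K_inv G K}"
    using F(3) inv_part_subset_K_inv by (fastforce simp: deg_part_def)
  then show "u \<in> trace_ideal G K"
    unfolding trace_ideal_def F(1) by (intro fsm.span_sum fsm.span_scale fsm.span_base) blast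
qed

text \<open>The elements of \<open>R\<close> without components below degree \<open>N\<close> and with component of degree \<open>N\<close>
  in \<open>L\<close> form an ideal, which contains all homogeneous products and hence the trace ideal.\<close>

lemma trace_ideal_components:
  assumes "w \<in> trace_ideal G K"
  obtains p where "w = to_fract p" "\<And>n. n < N \<Longrightarrow> component p n = 0" "to_fract (component p N) \<in> L"
proof -
  define T where
    "T = {to_fract p | p. (\<forall>n<N. component p n = 0) \<and> to_fract (component p N) \<in> L}"
  have T: "fsm.subspace T"
  proof (rule fsm.subspaceI)
    show "0 \<in> T"
      unfolding T_def by (rule CollectI, rule exI[of _ 0]) (simp add: component_zero span_products_zero)
    fix u v assume "u \<in> T" "v \<in> T"
    then obtain p q where p: "u = to_fract p" "\<forall>n<N. component p n = 0" "to_fract (component p N) \<in> L"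
      and q: "v = to_fract q" "\<forall>n<N. component q n = 0" "to_fract (component q N) \<in> L"
      by (auto simp: T_def)
    then show "u + v \<in> T"
      unfolding T_def
      by (intro CollectI exI[of _ "p + q"]) (simp add: component_add span_products_add)
  next
    fix r u assume "u \<in> T"
    then obtain p where p: "u = to_fract p" "\<forall>n<N. component p n = 0" "to_fract (component p N) \<in> L"
      by (auto simp: T_def)
    have "component (r * p) n = 0" if "n < N" for n
      unfolding component_mult using p(2) that by (intro sum.neutral) auto
    \<comment> \<open>All other terms involve a component of \<open>p\<close> below degree
      \<open>N\<close>. The surviving factor \<open>component r 0\<close> is a scalar from
      \<open>G 0\<close>, under which \<open>L\<close> is closed.\<close>
    moreover have "component (r * p) N = component r 0 * component p N"
    proof -
      have "component (r * p) N = (\<Sum>i\<in>{0}. component r i * component p (N - i))"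
        unfolding component_mult using p(2) by (intro sum.mono_neutral_right) auto
      then show ?thesis by simp
    qed
    ultimately show "fsmult r u \<in> T"
      unfolding T_def using p component_mem[of r 0]
      by (intro CollectI exI[of _ "r * p"]) (simp add: fsmult_def span_products_scale)
  qed
  have hom: "x * y \<in> T" if xy: "x \<in> deg_part G K i" "y \<in> inv_part G K j" for x y i j
  proof (cases "x * y = 0")
    case True
    then show ?thesis using fsm.subspace_0[OF T] by (simp only:)
  next
    case False
    obtain p where p: "x * y = to_fract p" "0 \<le> i + j" "p \<in> G (nat (i + j))"
      using prod_mem[OF xy False] by blast
    \<comment> \<open>Both factors are nonzero here, so their degrees are bounded below by the
      minimal ones.\<close>
    have le: "- a_inv G K \<le> i" "b_inv G K \<le> j"
      using xy False by (auto intro!: a_inv_le b_inv_le simp: deg_part_ne_iff inv_part_ne_iff)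
    then have ge: "N \<le> nat (i + j)" using int_N by linarith
    have comp: "component p n = (if n = nat (i + j) then p else 0)" for n
      using component_homogeneous[OF p(3)] .
    have "to_fract (component p N) \<in> L"
    proof (cases "N = nat (i + j)")
      case True
      \<comment> \<open>Two lower bounds whose sum is attained are both attained;
        \<open>0 \<le> i + j\<close> ensures that \<open>nat\<close> does not truncate.\<close>
      with le p(2) int_N have "i = - a_inv G K" "j = b_inv G K" by linarith+
      then show ?thesis using xy True comp p(1) span_products_base by metis
    qed (simp add: comp span_products_zero)
    then show ?thesis unfolding T_def using p(1) ge comp by auto
  qed
  have "x * y \<in> T" if "x \<in> K" "y \<in> K_inv G K" for x y
  proof -
    from decomp_ex[OF that(1)] obtain c where c: "decomp (deg_part G K) x c" by blast
    from that(2) obtain e where e: "decomp (inv_part G K) y e" by (auto simp: K_inv_def sum_of_def)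
    have "x * y = (\<Sum>i | c i \<noteq> 0. \<Sum>j | e j \<noteq> 0. c i * e j)"
      using c e by (simp add: decomp_def sum_product)
    also have "\<dots> \<in> T"
      using c e by (intro fsm.subspace_sum[OF T] hom) (auto simp: decomp_def)
    finally show ?thesis .
  qed
  then have "trace_ideal G K \<subseteq> T"
    unfolding trace_ideal_def by (intro fsm.span_minimal[OF _ T]) auto
  with assms that show ?thesis by (auto simp: T_def)
qed

text \<open>The irrelevant ideal contains a nonzero element of \<open>L\<close>, so
  \<open>N > 0\<close>. It also contains all of \<open>G (m_inv G)\<close> and \<open>G N\<close>:
  the former cannot lie below degree \<open>N\<close>, and the latter must lie in
  \<open>L\<close>.\<close>

lemma trace_eq_irrelevant_imp:
  assumes "trace_ideal G K = to_fract ` irrelevant_ideal G"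
  shows "N = m_inv G" "L = to_fract ` G N"
proof -
  obtain x y p where xy: "x \<in> deg_part G K (- a_inv G K)" "y \<in> inv_part G K (b_inv G K)"
      "x * y = to_fract p" "p \<in> G N" "p \<noteq> 0"
    using obtain_lowest by blast
  then have "to_fract p \<in> trace_ideal G K"
    using L_subset_trace_ideal span_products_base by (metis subsetD)
  then have "component p 0 = 0" using assms by (auto simp: mem_irrelevant_ideal_iff)
  with xy have N0: "N \<noteq> 0" by (metis component_homogeneous)
  \<comment> \<open>The element \<open>p\<close> of positive degree \<open>N\<close> shows that the
    minimum is taken over a nonempty set.\<close>
  have m: "0 < m_inv G \<and> G (m_inv G) \<noteq> {0}"
    unfolding m_inv_def using N0 xy(4,5) LeastI[of "\<lambda>n. 0 < n \<and> G n \<noteq> {0}" N] by auto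
  have G_trace: "to_fract r \<in> trace_ideal G K" if "r \<in> G n" "n \<noteq> 0" for r n
    using that assms by (auto simp: mem_irrelevant_ideal_iff component_homogeneous)
  obtain r where r: "r \<in> G (m_inv G)" "r \<noteq> 0" using m zero_mem by blast
  obtain q where "to_fract r = to_fract q" "\<And>n. n < N \<Longrightarrow> component q n = 0"
    using trace_ideal_components[OF G_trace[OF r(1)]] m by auto
  then have "\<not> m_inv G < N" using r component_homogeneous by (metis to_fract_eq_iff)
  with m_inv_le[OF N0] show "N = m_inv G" by simp
  have "to_fract u \<in> L" if "u \<in> G N" for u
  proof -
    from trace_ideal_components[OF G_trace[OF that N0]]
    obtain q where "to_fract u = to_fract q" "to_fract (component q N) \<in> L"
      by blast
    then show ?thesis using that by (simp add: component_homogeneous)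
  qed
  with L_subset show "L = to_fract ` G N" by blast
qed

text \<open>For \<open>N = 1\<close> the trace ideal has no components in degree 0. Conversely, the
  elements that agree with their degree 0 component modulo the trace ideal form a subring containing
  \<open>G 0\<close> and \<open>G 1\<close>, which generate \<open>R\<close>.\<close>

lemma standard_imp_trace_eq_irrelevant:
  assumes "standard_graded G" "N = 1" "L = to_fract ` G 1"
  shows "trace_ideal G K = to_fract ` irrelevant_ideal G"
proof
  show sub: "trace_ideal G K \<subseteq> to_fract ` irrelevant_ideal G"
  proof
    fix w assume "w \<in> trace_ideal G K"
    then obtain p where "w = to_fract p" "component p 0 = 0"
      using trace_ideal_components assms(2) by (metis zero_less_one)
    then show "w \<in> to_fract ` irrelevant_ideal G" by (simp add: mem_irrelevant_ideal_iff)
  qed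
  define A where "A = {r. to_fract (r - component r 0) \<in> trace_ideal G K}"
  have scale: "to_fract r * u \<in> trace_ideal G K" if "u \<in> trace_ideal G K" for r u
    using that fsm.span_scale unfolding trace_ideal_def fsmult_def by blast
  have "subring_gen (G 0 \<union> G 1) \<subseteq> A"
    unfolding subring_gen_def
  proof (rule hull_minimal)
    show "G 0 \<union> G 1 \<subseteq> A"
    proof
      fix r assume "r \<in> G 0 \<union> G 1"
      then consider "r \<in> G 0" | "r \<in> G 1" by blast
      then show "r \<in> A"
      proof cases
        case 1
        then show ?thesis
          by (simp add: A_def component_homogeneous trace_ideal_def fsm.span_zero)
      next
        case 2
        then show ?thesis
          using assms(3) L_subset_trace_ideal by (auto simp: A_def component_homogeneous)
      qed
    qed
    have "1 \<in> A"
      by (simp add: A_def component_homogeneous[OF one_mem] trace_ideal_def fsm.span_zero)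
    moreover have "r - q \<in> A \<and> r * q \<in> A" if "r \<in> A" "q \<in> A" for r q
    proof -
      have "component r 0 = component (r - q) 0 + component q 0"
        by (simp flip: component_add)
      then have "r - q - component (r - q) 0 = (r - component r 0) - (q - component q 0)"
        by (simp add: algebra_simps)
      \<comment> \<open>Closure under products: both summands are multiples of elements already in
        the trace ideal.\<close>
      moreover have "r * q - component (r * q) 0 =
          q * (r - component r 0) + component r 0 * (q - component q 0)"
        by (simp add: component_mult algebra_simps)
      moreover have "to_fract (r - component r 0) \<in> trace_ideal G K"
          "to_fract (q - component q 0) \<in> trace_ideal G K"
        using that by (simp_all add: A_def)
      moreover have "u - v \<in> trace_ideal G K" "u + v \<in> trace_ideal G K"
        if "u \<in> trace_ideal G K" "v \<in> trace_ideal G K" for u v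
        using that by (simp_all add: trace_ideal_def fsm.span_diff fsm.span_add)
      ultimately show ?thesis
        unfolding A_def mem_Collect_eq by (metis scale to_fract_add to_fract_diff to_fract_mult)
    qed
    ultimately show "1 \<in> A \<and> (\<forall>r\<in>A. \<forall>q\<in>A. r - q \<in> A \<and> r * q \<in> A)" by blast
  qed
  then have "A = UNIV" using assms(1) by (auto simp: standard_graded_def)
  then have "to_fract (r - component r 0) \<in> trace_ideal G K" for r
    unfolding A_def by blast
  then show "to_fract ` irrelevant_ideal G \<subseteq> trace_ideal G K"
    by (metis diff_zero image_subsetI mem_irrelevant_ideal_iff)
qed

end

section \<open>Canonical ideals as nonzero graded fractional ideals\<close>

lemma canonical_imp_graded_fractional:
  fixes G :: "nat \<Rightarrow> 'a::idom set"
  assumes "normal_graded_domain G" "canonical_fractional_ideal G xs d K"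
  shows "graded_fractional G K"
proof -
  interpret graded_domain G
    using assms(1) by unfold_locales (simp add: normal_graded_domain_def)
  have K: "graded_fractional_ideal G K" "hQ G = {x / to_fract s | x s. x \<in> K \<and> s \<in> hom_units G}"
    using assms(2) by (auto simp: canonical_fractional_ideal_def)
  obtain \<iota> where \<iota>: "\<And>n. bij_betw (\<iota> n) (can_mod G xs d n) (deg_part G K n)"
    using assms(2) by (auto simp: canonical_fractional_ideal_def)
  have "(\<lambda>_. 0) \<in> can_mod G xs d n" for n by (simp add: can_mod_def zero_mem)
  then have "deg_part G K n \<noteq> {}" for n using \<iota>[of n] by (auto simp: bij_betw_def)
  then have ne: "hQ_deg G n \<noteq> {}" for n by (auto simp: deg_part_def)
  \<comment> \<open>Every element of \<open>hQ G\<close> is a fraction with numerator in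
    \<open>K\<close>; writing 1 in this way yields a nonzero numerator.\<close>
  have "1 \<in> hom_units G" using one_mem by (auto simp: hom_units_def)
  then have "1 \<in> hQ G" unfolding hQ_def
    by (intro CollectI exI[of _ 1]) auto
  then obtain x s where "x \<in> K" "1 = x / to_fract s" unfolding K(2) by blast
  then have "\<exists>x\<in>K. x \<noteq> 0" by (intro bexI[of _ x]) auto
  moreover have "\<And>c. c \<in> G 0 \<Longrightarrow> c \<noteq> 0 \<Longrightarrow> \<exists>c'\<in>G 0. c * c' = 1"
    using assms(1) by (simp add: normal_graded_domain_def)
  ultimately show ?thesis using K(1) ne by unfold_locales
qed

theorem proposition2p2:
  fixes G :: "nat \<Rightarrow> 'a::idom set"
    and xs :: "'a list"
    and d :: nat
    and K :: "'a fract set"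
  assumes "normal_graded_domain G"
    and "hom_generators G xs"
    and "krull_dim TYPE('a) = enat d"
    and "canonical_fractional_ideal G xs d K"
  shows
    "(- a_inv G K + b_inv G K \<ge> 0 \<and>
      (- a_inv G K + b_inv G K = 0 \<longleftrightarrow> free_module K) \<and>
      (\<not> free_module K \<longrightarrow> - a_inv G K + b_inv G K \<ge> int (m_inv G))) \<and>
     (trace_ideal G K = to_fract ` irrelevant_ideal G \<longrightarrow>
      - a_inv G K + b_inv G K = int (m_inv G) \<and>
      span_products G (deg_part G K (- a_inv G K)) (inv_part G K (b_inv G K)) =
        to_fract ` G (m_inv G)) \<and>
     (standard_graded G \<and> - a_inv G K + b_inv G K = 1 \<and>
      span_products G (deg_part G K (- a_inv G K)) (inv_part G K (b_inv G K)) =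
        to_fract ` G 1 \<longrightarrow>
      trace_ideal G K = to_fract ` irrelevant_ideal G)"
proof -
  interpret graded_fractional G K
    using assms by (intro canonical_imp_graded_fractional)
  have "N = 0 \<longleftrightarrow> free_module K" using free_if_N_eq_0 N_eq_0_if_free by blast
  then have "\<not> free_module K \<longrightarrow> m_inv G \<le> N" using m_inv_le by blast
  \<comment> \<open>Replacing \<open>- a_inv G K + b_inv G K\<close> by \<open>int N\<close> makes
    nonnegativity immediate and turns the other claims into statements about
    \<open>N\<close>.\<close>
  with \<open>N = 0 \<longleftrightarrow> free_module K\<close> trace_eq_irrelevant_imp standard_imp_trace_eq_irrelevant
  show ?thesis unfolding int_N[symmetric] by auto
qed

end
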